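(* Let $X \in \{\mathrm{LD},\mathrm{LTD},\mathrm{OD},\mathrm{OTD},\mathrm{ID},\mathrm{ITD},\mathrm{FD},\mathrm{FTD}\}$ and let $G$ be an X-admissible graph on $n$ vertices. Then $$\gamma^{X}(G) \ge \begin{cases} \lfloor \log_2 n \rfloor & \text{if } X \in \{\mathrm{LD},\mathrm{LTD}\},\\ \lceil \log_2 n\rceil & \text{if } X=\mathrm{OD},\\ \lceil \log_2(n+1)\rceil & \text{if } X\in\{\mathrm{OTD},\mathrm{ID},\mathrm{ITD}\},\\ 1+\lfloor\log_2 n\rfloor & \text{if } X=\mathrm{FD},\\ 1+\lfloor \log_2(n+1)\rfloor & \text{if } X=\mathrm{FTD}.\end{cases}$$
   Context: Graphs are finite, simple and undirected. For a graph $G=(V,E)$ and $v\in V$, $N(v)$ is the open neighborhood and $N[v]=N(v)\cup\{v\}$ the closed neighborhood. A set $C\subseteq V$ is dominating (resp. total-dominating) if $N[v]\cap C\neq\emptyset$ (resp. $N(v)\cap C\ne\emptyset$) for all $v\in V$. It is location-separating (L-separating) if $N(u)\cap C\neq N(v)\cap C$ for all distinct $u,v\in V\setminus C$; open-separating (O-separating) if $N(u)\cap C\neq N(v)\cap C$ for all distinct $u,v\in V$; closed-separating (I-separating) if $N[u]\cap C\neq N[v]\cap C$ for all distinct $u,v\in V$; full-separating (F-separating) if it is both open- and closed-separating. For $S\in\{L,O,I,F\}$, an $S$D-code (resp. $S$TD-code) is an $S$-separating set that is dominating (resp. total-dominating); this defines LD-, LTD-, OD-, OTD-, ID-, ITD-,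 FD- and FTD-codes. A graph is X-admissible if it has an X-code; $\gamma^{X}(G)$ is the minimum cardinality of an X-code of $G$. *)

theory Defs
  imports Complex_Main
begin

locale simple_graph =
  fixes V :: "'a set" and E :: "'a set set"
  assumes finite_verts: "finite V"
    and edges_pairs: "E \<subseteq> {{u, v} | u v. u \<in> V \<and> v \<in> V \<and> u \<noteq> v}"

definition open_nbhd :: "'a set \<Rightarrow> 'a set set \<Rightarrow> 'a \<Rightarrow> 'a set" where
  "open_nbhd V E v = {u \<in> V. {u, v} \<in> E}"

definition closed_nbhd :: "'a set \<Rightarrow> 'a set set \<Rightarrow> 'a \<Rightarrow> 'a set" where
  "closed_nbhd V E v = open_nbhd V E v \<union> {v}"

definition dominating :: "'a set \<Rightarrow> 'a set set \<Rightarrow> 'a set \<Rightarrow> bool" where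
  "dominating V E C \<longleftrightarrow> C \<subseteq> V \<and> (\<forall>v\<in>V. closed_nbhd V E v \<inter> C \<noteq> {})"

definition total_dominating :: "'a set \<Rightarrow> 'a set set \<Rightarrow> 'a set \<Rightarrow> bool" where
  "total_dominating V E C \<longleftrightarrow> C \<subseteq> V \<and> (\<forall>v\<in>V. open_nbhd V E v \<inter> C \<noteq> {})"

definition location_separating :: "'a set \<Rightarrow> 'a set set \<Rightarrow> 'a set \<Rightarrow> bool" where
  "location_separating V E C \<longleftrightarrow> C \<subseteq> V \<and>
     (\<forall>u\<in>V - C. \<forall>v\<in>V - C. u \<noteq> v \<longrightarrow> open_nbhd V E u \<inter> C \<noteq> open_nbhd V E v \<inter> C)"

definition open_separating :: "'a set \<Rightarrow> 'a set set \<Rightarrow> 'a set \<Rightarrow> bool" where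
  "open_separating V E C \<longleftrightarrow> C \<subseteq> V \<and>
     (\<forall>u\<in>V. \<forall>v\<in>V. u \<noteq> v \<longrightarrow> open_nbhd V E u \<inter> C \<noteq> open_nbhd V E v \<inter> C)"

definition closed_separating :: "'a set \<Rightarrow> 'a set set \<Rightarrow> 'a set \<Rightarrow> bool" where
  "closed_separating V E C \<longleftrightarrow> C \<subseteq> V \<and>
     (\<forall>u\<in>V. \<forall>v\<in>V. u \<noteq> v \<longrightarrow> closed_nbhd V E u \<inter> C \<noteq> closed_nbhd V E v \<inter> C)"

definition full_separating :: "'a set \<Rightarrow> 'a set set \<Rightarrow> 'a set \<Rightarrow> bool" where
  "full_separating V E C \<longleftrightarrow> open_separating V E C \<and> closed_separating V E C"

datatype code_type = LD | LTD | OD | OTD | ID | ITD | FD | FTD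

fun is_code :: "code_type \<Rightarrow> 'a set \<Rightarrow> 'a set set \<Rightarrow> 'a set \<Rightarrow> bool" where
  "is_code LD V E C \<longleftrightarrow> location_separating V E C \<and> dominating V E C"
| "is_code LTD V E C \<longleftrightarrow> location_separating V E C \<and> total_dominating V E C"
| "is_code OD V E C \<longleftrightarrow> open_separating V E C \<and> dominating V E C"
| "is_code OTD V E C \<longleftrightarrow> open_separating V E C \<and> total_dominating V E C"
| "is_code ID V E C \<longleftrightarrow> closed_separating V E C \<and> dominating V E C"
| "is_code ITD V E C \<longleftrightarrow> closed_separating V E C \<and> total_dominating V E C"
| "is_code FD V E C \<longleftrightarrow> full_separating V E C \<and> dominating V E C"
| "is_code FTD V E C \<longleftrightarrow> full_separating V E C \<and> total_dominating V E C"

definition admissible :: "code_type \<Rightarrow> 'a set \<Rightarrow> 'a set set \<Rightarrow> bool" where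
  "admissible X V E \<longleftrightarrow> (\<exists>C. is_code X V E C)"

text \<open>Meaningful only for finite, admissible graphs; otherwise \<^const>\<open>Min\<close> is unspecified.\<close>

definition code_number :: "code_type \<Rightarrow> 'a set \<Rightarrow> 'a set set \<Rightarrow> nat" where
  "code_number X V E = Min {card C | C. is_code X V E C}"

end

theory Submission
  imports Defs
begin

text \<open>The traces of neighborhoods on a code \<open>C\<close> are subsets of \<open>C\<close>, so separation bounds
  the number of vertices by \<open>2 ^ card C\<close>, and domination removes the empty trace. For FTD-codes
  one more trace is lost: if both the open and the closed traces were injective and exhausted the
  nonempty subsets of \<open>C\<close>, then their cardinalities would have the same sum over \<open>V\<close>;
  but open traces are contained in closed ones, strictly for vertices in \<open>C\<close>.\<close>

lemma card_less_two_power: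
  assumes "finite C" and inj: "inj_on t A" and sub: "\<And>v. v \<in> A \<Longrightarrow> t v \<subseteq> C \<and> t v \<noteq> {}"
  shows "card A < 2 ^ card C"
proof -
  have "t ` A \<subseteq> Pow C" "{} \<in> Pow C" "{} \<notin> t ` A" using sub by auto
  then have "t ` A \<subset> Pow C" by blast
  then have "card (t ` A) < card (Pow C)"
    using \<open>finite C\<close> by (intro psubset_card_mono) auto
  then show ?thesis
    using \<open>finite C\<close> by (simp add: card_image[OF inj] card_Pow)
qed

lemma card_le_two_power:
  assumes "finite C" and inj: "inj_on t A" and sub: "\<And>v. v \<in> A \<Longrightarrow> t v \<subseteq> C"
  shows "card A \<le> 2 ^ card C"
proof -
  have "card (t ` A) \<le> card (Pow C)"
    using \<open>finite C\<close> sub by (intro card_mono) auto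
  then show ?thesis
    using \<open>finite C\<close> by (simp add: card_image[OF inj] card_Pow)
qed

text \<open>Extremal case of the count: \<open>C\<close> has only \<open>2 ^ card C - 1\<close>
  nonempty subsets, so an injective family of at least that many must hit every one.\<close>

lemma image_Pow_eqI:
  assumes "finite C" and inj: "inj_on t A" and sub: "\<And>v. v \<in> A \<Longrightarrow> t v \<subseteq> C \<and> t v \<noteq> {}"
    and card: "2 ^ card C \<le> Suc (card A)"
  shows "t ` A = Pow C - {{}}"
proof (rule card_seteq)
  show "card (Pow C - {{}}) \<le> card (t ` A)"
    using \<open>finite C\<close> card by (simp add: card_image[OF inj] card_Pow)
qed (use \<open>finite C\<close> sub in auto)

text \<open>Here \<open>s\<close> and \<open>t\<close> stand for the open and closed traces and
  \<open>c\<close> for a code vertex. Nonemptiness passes from \<open>s v\<close> to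
  \<open>t v\<close> by inclusion.\<close>

lemma Suc_card_less_two_power:
  assumes "finite C" "finite A"
    and inj_s: "inj_on s A" and inj_t: "inj_on t A"
    and s: "\<And>v. v \<in> A \<Longrightarrow> s v \<noteq> {}"
    and st: "\<And>v. v \<in> A \<Longrightarrow> s v \<subseteq> t v"
    and t: "\<And>v. v \<in> A \<Longrightarrow> t v \<subseteq> C"
    and c: "c \<in> A" "s c \<noteq> t c"
  shows "Suc (card A) < 2 ^ card C"
proof (rule ccontr)
  assume "\<not> ?thesis"
  then have card: "2 ^ card C \<le> Suc (card A)" by simp
  have "s ` A = Pow C - {{}}"
    by (rule image_Pow_eqI[OF \<open>finite C\<close> inj_s _ card]) (use s st t in blast)
  moreover have "t ` A = Pow C - {{}}"
    by (rule image_Pow_eqI[OF \<open>finite C\<close> inj_t _ card]) (use s st t in blast)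
  ultimately have eq: "s ` A = t ` A" by simp
  have fin: "finite (t v)" if "v \<in> A" for v
    using \<open>finite C\<close> t that finite_subset by blast
  have "(\<Sum>v\<in>A. card (s v)) < (\<Sum>v\<in>A. card (t v))"
  proof (rule sum_strict_mono_ex1[OF \<open>finite A\<close>])
    show "\<forall>v\<in>A. card (s v) \<le> card (t v)"
      using fin st by (simp add: card_mono)
    show "\<exists>v\<in>A. card (s v) < card (t v)"
      using c fin st by (intro bexI[of _ c] psubset_card_mono) auto
  qed
  \<comment> \<open>By injectivity, each side is the sum of \<open>card\<close> over the common
    image.\<close>
  moreover have "(\<Sum>v\<in>A. card (s v)) = (\<Sum>v\<in>A. card (t v))"
    using sum.reindex[OF inj_s, of card] sum.reindex[OF inj_t, of card] eq by simp
  ultimately show False by simp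
qed

context simple_graph
begin

lemma notin_open_nbhd: "v \<notin> open_nbhd V E v"
proof
  assume "v \<in> open_nbhd V E v"
  then have "{v, v} \<in> E" by (simp add: open_nbhd_def)
  with edges_pairs have "{v, v} \<in> {{a, b} | a b. a \<in> V \<and> b \<in> V \<and> a \<noteq> b}" by (rule subsetD)
  then show False by (auto simp: doubleton_eq_iff)
qed

lemma open_nbhd_subset_closed_nbhd: "open_nbhd V E v \<subseteq> closed_nbhd V E v"
  by (auto simp: closed_nbhd_def)

lemma total_dominating_imp_dominating: "total_dominating V E C \<Longrightarrow> dominating V E C"
  using open_nbhd_subset_closed_nbhd unfolding total_dominating_def dominating_def by blast

text \<open>Location separation says nothing about code vertices, so traces count only
  \<open>V - C\<close>. Adding back the \<open>card C < 2 ^ card C\<close> code vertices costs at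
  most one doubling.\<close>

lemma card_less_location:
  assumes "location_separating V E C" "dominating V E C"
  shows "card V < 2 ^ Suc (card C)"
proof -
  have CV: "C \<subseteq> V" and dom: "\<And>v. v \<in> V \<Longrightarrow> closed_nbhd V E v \<inter> C \<noteq> {}"
    using assms(2) by (auto simp: dominating_def)
  have fin: "finite C" using CV finite_verts by (rule finite_subset)
  have "card (V - C) < 2 ^ card C"
  proof (rule card_less_two_power[OF fin])
    show "inj_on (\<lambda>v. open_nbhd V E v \<inter> C) (V - C)"
      using assms(1) by (fastforce simp: location_separating_def inj_on_def)
    \<comment> \<open>Outside \<open>C\<close> the open and closed traces agree, so plain domination
      already makes the open trace nonempty.\<close>
    show "open_nbhd V E v \<inter> C \<subseteq> C \<and> open_nbhd V E v \<inter> C \<noteq> {}" if "v \<in> V - C" for v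
      using dom[of v] that by (auto simp: closed_nbhd_def)
  qed
  moreover have "card V = card (V - C) + card C"
    using CV fin card_mono[OF finite_verts CV] by (simp add: card_Diff_subset)
  moreover have "card C < 2 ^ card C" by (rule less_exp)
  ultimately show ?thesis unfolding power_Suc by linarith
qed

text \<open>A code vertex dominates itself, so its open trace may be empty even for a dominating
  code; hence the bound is not strict.\<close>

lemma card_le_open:
  assumes "open_separating V E C"
  shows "card V \<le> 2 ^ card C"
proof (rule card_le_two_power)
  show "finite C"
    using assms finite_verts finite_subset by (auto simp: open_separating_def)
  show "inj_on (\<lambda>v. open_nbhd V E v \<inter> C) V"
    using assms by (fastforce simp: open_separating_def inj_on_def)
qed auto

lemma card_less_open_total:
  assumes "open_separating V E C" "total_dominating V E C"
  shows "card V < 2 ^ card C"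
proof (rule card_less_two_power)
  show "finite C"
    using assms finite_verts finite_subset by (auto simp: open_separating_def)
  show "inj_on (\<lambda>v. open_nbhd V E v \<inter> C) V"
    using assms(1) by (fastforce simp: open_separating_def inj_on_def)
qed (use assms(2) in \<open>auto simp: total_dominating_def\<close>)

lemma card_less_closed:
  assumes "closed_separating V E C" "dominating V E C"
  shows "card V < 2 ^ card C"
proof (rule card_less_two_power)
  show "finite C"
    using assms finite_verts finite_subset by (auto simp: closed_separating_def)
  show "inj_on (\<lambda>v. closed_nbhd V E v \<inter> C) V"
    using assms(1) by (fastforce simp: closed_separating_def inj_on_def)
qed (use assms(2) in \<open>auto simp: dominating_def\<close>)

lemma Suc_card_less_full_total:
  assumes "full_separating V E C" "total_dominating V E C" "V \<noteq> {}"
  shows "Suc (card V) < 2 ^ card C"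
proof -
  have CV: "C \<subseteq> V" and dom: "\<And>v. v \<in> V \<Longrightarrow> open_nbhd V E v \<inter> C \<noteq> {}"
    using assms(2) by (auto simp: total_dominating_def)
  \<comment> \<open>Dominating any single vertex forces the code to be nonempty.\<close>
  obtain c where c: "c \<in> C" using dom assms(3) by blast
  show ?thesis
  proof (rule Suc_card_less_two_power)
    show "finite C" using CV finite_verts by (rule finite_subset)
    show "inj_on (\<lambda>v. open_nbhd V E v \<inter> C) V"
      using assms(1) by (fastforce simp: full_separating_def open_separating_def inj_on_def)
    show "inj_on (\<lambda>v. closed_nbhd V E v \<inter> C) V"
      using assms(1) by (fastforce simp: full_separating_def closed_separating_def inj_on_def)
    show "c \<in> V" using c CV by blast
    \<comment> \<open>The vertex \<open>c\<close> lies in its own closed trace but, without loops,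
      not in its open one.\<close>
    show "open_nbhd V E c \<inter> C \<noteq> closed_nbhd V E c \<inter> C"
      using c notin_open_nbhd by (auto simp: closed_nbhd_def)
  qed (use dom open_nbhd_subset_closed_nbhd finite_verts in auto)
qed

text \<open>Codes are subsets of the finite set \<open>V\<close> and admissibility supplies one, so
  \<open>Min\<close> is attained. It then suffices to bound one code of minimum size.\<close>

lemma ex_code_card_eq_code_number:
  assumes "admissible X V E"
  shows "\<exists>C. is_code X V E C \<and> card C = code_number X V E"
proof -
  have "C \<subseteq> V" if "is_code X V E C" for C
    using that by (cases X) (auto simp: dominating_def total_dominating_def)
  then have "{card C | C. is_code X V E C} \<subseteq> card ` Pow V" by auto
  then have "finite {card C | C. is_code X V E C}"
    by (rule finite_subset) (simp add: finite_verts)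
  moreover have "{card C | C. is_code X V E C} \<noteq> {}"
    using assms by (auto simp: admissible_def)
  ultimately have "code_number X V E \<in> {card C | C. is_code X V E C}"
    unfolding code_number_def by (rule Min_in)
  then show ?thesis by auto
qed

end

lemma ceiling_log2_le:
  assumes "0 < m" "m \<le> 2 ^ k"
  shows "\<lceil>log 2 (real m)\<rceil> \<le> int k"
proof -
  have "real m \<le> 2 ^ k" using assms(2) by (metis of_nat_le_iff of_nat_numeral of_nat_power)
  with assms(1) have "log 2 (real m) \<le> real k" by (intro log_of_power_le) auto
  then show ?thesis by (simp add: ceiling_le_iff)
qed

text \<open>Between integers the strict bound means
  \<open>1 + \<lfloor>log 2 m\<rfloor> \<le> k\<close>, the form of the FD and FTD bounds.\<close>

lemma floor_log2_less:
  assumes "0 < m" "m < 2 ^ k"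
  shows "\<lfloor>log 2 (real m)\<rfloor> < int k"
proof -
  have "real m < 2 ^ k" using assms(2) by (metis of_nat_less_iff of_nat_numeral of_nat_power)
  with assms(1) have "log 2 (real m) < real k" by (intro log_of_power_less) auto
  then show ?thesis by (simp add: floor_less_iff)
qed

theorem corollary3:
  fixes V :: "'a set" and E :: "'a set set" and X :: code_type and n :: nat
  assumes "simple_graph V E"
    and "V \<noteq> {}"
    and "card V = n"
    and "admissible X V E"
  shows "int (code_number X V E) \<ge>
    (case X of
       LD \<Rightarrow> \<lfloor>log 2 (real n)\<rfloor>
     | LTD \<Rightarrow> \<lfloor>log 2 (real n)\<rfloor>
     | OD \<Rightarrow> \<lceil>log 2 (real n)\<rceil>
     | OTD \<Rightarrow> \<lceil>log 2 (real n + 1)\<rceil>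
     | ID \<Rightarrow> \<lceil>log 2 (real n + 1)\<rceil>
     | ITD \<Rightarrow> \<lceil>log 2 (real n + 1)\<rceil>
     | FD \<Rightarrow> 1 + \<lfloor>log 2 (real n)\<rfloor>
     | FTD \<Rightarrow> 1 + \<lfloor>log 2 (real n + 1)\<rfloor>)"
proof -
  interpret simple_graph V E by fact
  obtain C where C: "is_code X V E C" and k: "code_number X V E = card C"
    using ex_code_card_eq_code_number[OF assms(4)] by metis
  have n: "0 < n" using assms(2,3) finite_verts by (auto simp: card_gt_0_iff)
  have S: "real n + 1 = real (Suc n)" by simp
  \<comment> \<open>The exponent \<open>Suc (card C)\<close> turns the strict floor bound into a
    weak one for \<open>card C\<close>.\<close>
  have loc: "\<lfloor>log 2 (real n)\<rfloor> \<le> int (card C)"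
    if "location_separating V E C" "dominating V E C"
    using floor_log2_less[OF n, of "Suc (card C)"] card_less_location[OF that] assms(3) by simp
  \<comment> \<open>The strict count is read as \<open>Suc n \<le> 2 ^ card C\<close>.\<close>
  have up: "\<lceil>log 2 (real n + 1)\<rceil> \<le> int (card C)" if "card V < 2 ^ card C"
    unfolding S using that assms(3) by (intro ceiling_log2_le) auto
  show ?thesis
  proof (cases X)
    case LD
    then show ?thesis using C k loc by simp
  next
    case LTD
    then show ?thesis using C k loc total_dominating_imp_dominating by simp
  next
    case OD
    then show ?thesis using C k ceiling_log2_le[OF n] card_le_open assms(3) by simp
  next
    case OTD
    then show ?thesis using C k up card_less_open_total by simp
  next
    case ID
    then show ?thesis using C k up card_less_closed by simp
  next
    case ITD
    then show ?thesis using C k up card_less_closed total_dominating_imp_dominating by simp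
  next
    \<comment> \<open>Full separation contains closed separation, so the count for ID-codes applies.
      For positive \<open>n\<close>, \<open>1 + \<lfloor>log 2 n\<rfloor>\<close> equals
      \<open>\<lceil>log 2 (n + 1)\<rceil>\<close>.\<close>
    case FD
    then have "n < 2 ^ card C"
      using C card_less_closed assms(3) by (simp add: full_separating_def)
    from floor_log2_less[OF n this] FD k show ?thesis by simp
  next
    case FTD
    then have "Suc n < 2 ^ card C"
      using C Suc_card_less_full_total assms(2,3) by simp
    from floor_log2_less[OF _ this] have "\<lfloor>log 2 (real n + 1)\<rfloor> < int (card C)"
      unfolding S by simp
    with FTD k show ?thesis by simp
  qed
qed

end
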